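(* Let $X$ be a Banach function space over $[-\pi,\pi]$ with $1\in X_a$, and let $\{L_n\}_{n\in\mathbb{N}}$ be a sequence of positive linear operators $L_n:X_{2\pi}^S\to X_{2\pi}^S$. Suppose that $\sup_n\|L_n(1)\|_X=c<+\infty$. For $n\in\mathbb{N}$ let $\mu_n\ge0$ be defined by $$\mu_n^2=\pi^2\,\Big\|\,x\mapsto L_n\Big(\sin^2\tfrac{x-\cdot}{2}\Big)(x)\,\Big\|_X .$$ Then for every $f\in C_{2\pi}[-\pi,\pi]$ and every $n=1,2,3,\ldots$, $$\|L_n(f)-f\|_X\le\|f\|_\infty\|L_n(1)-1\|_X+(\|L_n(1)\|_X+1)\,\omega(f,\mu_n),$$ and if $L_n(1)=1$ then $$\|L_n(f)-f\|_X\le(c+1)\,\omega(f,\mu_n).$$ Moreover, if $f$ is also differentiable with $f'\in C_{2\pi}[-\pi,\pi]$, then $$\|L_n(f)-f\|_X\le\|f\|_\infty\|L_n(1)-1\|_X+\sqrt{c}\,\mu_n\|f'\|_\infty+(\sqrt{c}+1)\,\mu_n\,\omega(f',\mu_n),$$ and if in addition $L_n(1)=1$, then $$\|L_n(f)-f\|_X\le\sqrt{c}\,\mu_n\|f'\|_\infty+(\sqrt{c}+1)\,\mu_n\,\omega(f',\mu_n).$$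
   Context: Work on $[-\pi,\pi]$ with the Borel $\sigma$-algebra $\mathcal{S}$ and Lebesgue measure $\mu$. Let $\mathcal{M}$ be the set of measurable functions on $[-\pi,\pi]$ (identified when equal a.e.) and $\mathcal{M}^+$ the non-negative ones. A map $\rho:\mathcal{M}^+\to[0,+\infty]$ is a function norm if for all $f,g,f_n\in\mathcal{M}^+$, $a\ge 0$, $E\in\mathcal{S}$: (i) $\rho(f)=0\iff f=0$ a.e., $\rho(af)=a\rho(f)$, $\rho(f+g)\le\rho(f)+\rho(g)$; (ii) $g\le f$ a.e. implies $\rho(g)\le\rho(f)$; (iii) $f_n\uparrow f$ a.e. implies $\rho(f_n)\uparrow\rho(f)$; (iv) $\mu(E)<\infty$ implies $\rho(\chi_E)<\infty$; (v) $\mu(E)<\infty$ implies there is $C_E>0$, depending only on $E$ and $\rho$, with $\int_E f\,d\mu\le C_E\rho(f)$. The Banach function space $X$ generated by $\rho$ is the space of $f\in\mathcal{M}$ with $\|f\|_X:=\rho(|f|)<\infty$. A function $f\in X$ has absolutely continuous norm if $\|f\chi_{E_n}\|_X\to0$ for every sequence $E_n\in\mathcal{S}$ with $E_n\to\emptyset$ a.e. (i.e. $\chi_{E_n}\to0$ a.e.); $X_a$ is the set of all such $f$. Here $1$ is the constant function. For $\delta>0$, $T_\delta f(x)=f(x+\delta)$ if $x+\delta\in[-\pi,\pi]$ and $T_\delta f(x)=0$ otherwise. $X^S=X^S[-\pi,\pi]$ is the closure in $X$ of $\{f\in X:\lim_{\delta\to0}\|T_\delta f-f\|_X=0\}$.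 $X_{2\pi}^S$ is the Banach space of all measurable functions $f$ on $\mathbb{R}$ with $f|_{[-\pi,\pi]}\in X^S[-\pi,\pi]$ and $f(x+2\pi)=f(x)$ for a.e. $x\in\mathbb{R}$, normed by the $X$-norm of $f|_{[-\pi,\pi]}$ (also written $\|f\|_X$). A linear operator $L$ on $X_{2\pi}^S$ is positive if $f\ge0$ a.e. implies $L(f)\ge0$ a.e. $C_{2\pi}[-\pi,\pi]$ is the space of real-valued continuous $2\pi$-periodic functions (regarded as functions on $\mathbb{R}$), with sup-norm $\|\cdot\|_\infty$; when $1\in X_a$ it is contained in $X_{2\pi}^S$. The function $x\mapsto L_n(\sin^2\frac{x-\cdot}{2})(x)$ is, a.e., $\frac12\big(L_n(1)(x)-\cos x\,L_n(\cos)(x)-\sin x\,L_n(\sin)(x)\big)$. The modulus of continuity of $f$ is $\omega(f,\delta)=\sup\{|f(x)-f(y)|:x,y\in\mathbb{R},\ |x-y|\le\delta\}$ for $\delta>0$; by the same formula $\omega(f,0)=0$. *)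

theory Defs
  imports "HOL-Analysis.Analysis"
begin

text \<open>
  Functions on \<open>[-\<pi>,\<pi>]\<close> are represented by functions \<open>real \<Rightarrow> real\<close>; values outside
  the interval are irrelevant, because measurability and ``a.e.'' refer to \<open>leb_pi\<close>. In particular
  a function on the whole line and its restriction to \<open>[-\<pi>,\<pi>]\<close> are denoted by the same term.
  Functions equal a.e. are not quotiented; monotonicity in \<open>function_norm\<close> makes \<open>\<rho>\<close> invariant
  under a.e. equality.
\<close>

definition leb_pi :: "real measure" where
  "leb_pi = restrict_space lborel {-pi..pi}"

definition Mplus :: "(real \<Rightarrow> real) set" where
  "Mplus = {f \<in> borel_measurable leb_pi. \<forall>x\<in>{-pi..pi}. 0 \<le> f x}"

definition function_norm :: "((real \<Rightarrow> real) \<Rightarrow> ennreal) \<Rightarrow> bool" where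
  "function_norm \<rho> \<longleftrightarrow>
     (\<forall>f\<in>Mplus. \<rho> f = 0 \<longleftrightarrow> (AE x in leb_pi. f x = 0)) \<and>
     (\<forall>f\<in>Mplus. \<forall>a\<ge>0. \<rho> (\<lambda>x. a * f x) = ennreal a * \<rho> f) \<and>
     (\<forall>f\<in>Mplus. \<forall>g\<in>Mplus. \<rho> (\<lambda>x. f x + g x) \<le> \<rho> f + \<rho> g) \<and>
     (\<forall>f\<in>Mplus. \<forall>g\<in>Mplus. (AE x in leb_pi. g x \<le> f x) \<longrightarrow> \<rho> g \<le> \<rho> f) \<and>
     (\<forall>F f. (\<forall>n::nat. F n \<in> Mplus) \<longrightarrow> f \<in> Mplus \<longrightarrow>
        (AE x in leb_pi. incseq (\<lambda>n. F n x) \<and> (\<lambda>n. F n x) \<longlonglongrightarrow> f x) \<longrightarrow>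
        incseq (\<lambda>n. \<rho> (F n)) \<and> (\<lambda>n. \<rho> (F n)) \<longlonglongrightarrow> \<rho> f) \<and>
     (\<forall>E\<in>sets leb_pi. emeasure leb_pi E < \<infinity> \<longrightarrow> \<rho> (indicator E) < \<infinity>) \<and>
     (\<forall>E\<in>sets leb_pi. emeasure leb_pi E < \<infinity> \<longrightarrow>
        (\<exists>C>0. \<forall>f\<in>Mplus. (\<integral>\<^sup>+x\<in>E. ennreal (f x) \<partial>leb_pi) \<le> ennreal C * \<rho> f))"

text \<open>
  The norm is kept in \<open>ennreal\<close> since \<open>X\<close> need not be translation invariant, so that
  \<open>T\<^sub>\<delta> f - f\<close> may have infinite norm even for \<open>f \<in> X\<close>.
\<close>

definition Xnorm :: "((real \<Rightarrow> real) \<Rightarrow> ennreal) \<Rightarrow> (real \<Rightarrow> real) \<Rightarrow> ennreal" where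
  "Xnorm \<rho> f = \<rho> (\<lambda>x. \<bar>f x\<bar>)"

definition Xspace :: "((real \<Rightarrow> real) \<Rightarrow> ennreal) \<Rightarrow> (real \<Rightarrow> real) set" where
  "Xspace \<rho> = {f \<in> borel_measurable leb_pi. Xnorm \<rho> f < \<infinity>}"

definition Xa :: "((real \<Rightarrow> real) \<Rightarrow> ennreal) \<Rightarrow> (real \<Rightarrow> real) set" where
  "Xa \<rho> = {f \<in> Xspace \<rho>. \<forall>E. (\<forall>n::nat. E n \<in> sets leb_pi) \<longrightarrow>
      (AE x in leb_pi. (\<lambda>n. indicator (E n) x :: real) \<longlonglongrightarrow> 0) \<longrightarrow>
      (\<lambda>n. Xnorm \<rho> (\<lambda>x. f x * indicator (E n) x)) \<longlonglongrightarrow> 0}"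

definition translate :: "real \<Rightarrow> (real \<Rightarrow> real) \<Rightarrow> real \<Rightarrow> real" where
  "translate \<delta> f x = (if x + \<delta> \<in> {-pi..pi} then f (x + \<delta>) else 0)"

definition shift_continuous :: "((real \<Rightarrow> real) \<Rightarrow> ennreal) \<Rightarrow> (real \<Rightarrow> real) set" where
  "shift_continuous \<rho> = {f \<in> Xspace \<rho>.
      ((\<lambda>\<delta>. Xnorm \<rho> (\<lambda>x. translate \<delta> f x - f x)) \<longlongrightarrow> 0) (at_right 0)}"

definition XS :: "((real \<Rightarrow> real) \<Rightarrow> ennreal) \<Rightarrow> (real \<Rightarrow> real) set" where
  "XS \<rho> = {f \<in> Xspace \<rho>. \<forall>\<epsilon>>0. \<exists>g\<in>shift_continuous \<rho>. Xnorm \<rho> (\<lambda>x. f x - g x) < ennreal \<epsilon>}"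

definition XS2pi :: "((real \<Rightarrow> real) \<Rightarrow> ennreal) \<Rightarrow> (real \<Rightarrow> real) set" where
  "XS2pi \<rho> = {f \<in> borel_measurable lborel. f \<in> XS \<rho> \<and> (AE x in lborel. f (x + 2 * pi) = f x)}"

text \<open>
  An operator on classes modulo a.e. equality is given by a map on representatives. Its behaviour
  on functions outside \<open>XS2pi \<rho>\<close> is unconstrained.
\<close>

definition linear_operator ::
  "((real \<Rightarrow> real) \<Rightarrow> ennreal) \<Rightarrow> ((real \<Rightarrow> real) \<Rightarrow> real \<Rightarrow> real) \<Rightarrow> bool" where
  "linear_operator \<rho> L \<longleftrightarrow>
     (\<forall>f\<in>XS2pi \<rho>. L f \<in> XS2pi \<rho>) \<and>
     (\<forall>f\<in>XS2pi \<rho>. \<forall>g\<in>XS2pi \<rho>. (AE x in lborel. f x = g x) \<longrightarrow> (AE x in lborel. L f x = L g x)) \<and>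
     (\<forall>f\<in>XS2pi \<rho>. \<forall>g\<in>XS2pi \<rho>. AE x in lborel. L (\<lambda>t. f t + g t) x = L f x + L g x) \<and>
     (\<forall>f\<in>XS2pi \<rho>. \<forall>a. AE x in lborel. L (\<lambda>t. a * f t) x = a * L f x)"

definition positive_operator ::
  "((real \<Rightarrow> real) \<Rightarrow> ennreal) \<Rightarrow> ((real \<Rightarrow> real) \<Rightarrow> real \<Rightarrow> real) \<Rightarrow> bool" where
  "positive_operator \<rho> L \<longleftrightarrow>
     (\<forall>f\<in>XS2pi \<rho>. (AE x in lborel. 0 \<le> f x) \<longrightarrow> (AE x in lborel. 0 \<le> L f x))"

text \<open>
  The function \<open>x \<mapsto> L (sin\<^sup>2 ((x - \<cdot>) / 2)) x\<close>. For each \<open>x\<close> the function \<open>L (sin\<^sup>2 ((x - \<cdot>) / 2))\<close> is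
  determined only up to a null set depending on \<open>x\<close>, so evaluating it at \<open>x\<close> is meaningful only after
  expanding \<open>sin\<^sup>2 ((x - t) / 2) = (1 - cos x * cos t - sin x * sin t) / 2\<close> and using linearity.
\<close>

definition sin2_moment :: "((real \<Rightarrow> real) \<Rightarrow> real \<Rightarrow> real) \<Rightarrow> real \<Rightarrow> real" where
  "sin2_moment L x = (1/2) * (L (\<lambda>_. 1) x - cos x * L cos x - sin x * L sin x)"

definition C2pi :: "(real \<Rightarrow> real) set" where
  "C2pi = {f. continuous_on UNIV f \<and> (\<forall>x. f (x + 2 * pi) = f x)}"

text \<open>
  Real suprema; the sets are nonempty and bounded for \<open>f \<in> C2pi\<close> and \<open>\<delta> \<ge> 0\<close>.
\<close>

definition supnorm :: "(real \<Rightarrow> real) \<Rightarrow> real" where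
  "supnorm f = (SUP x. \<bar>f x\<bar>)"

definition modulus :: "(real \<Rightarrow> real) \<Rightarrow> real \<Rightarrow> real" where
  "modulus f \<delta> = Sup {\<bar>f x - f y\<bar> | x y. \<bar>x - y\<bar> \<le> \<delta>}"

end

theory Submission
  imports Defs
begin

text \<open>
  If \<open>\<bar>f x - f y\<bar> \<le> A + B (x - y)\<^sup>2\<close> for all \<open>x, y\<close>, then periodicity and \<open>\<bar>u\<bar> \<le> \<pi> \<bar>sin (u/2)\<bar>\<close> on
  \<open>[-\<pi>, \<pi>]\<close> let us replace \<open>(x - y)\<^sup>2\<close> by \<open>\<pi>\<^sup>2 sin\<^sup>2 ((x - y)/2)\<close>, and positivity of \<open>L\<close> gives
  \<open>\<parallel>L f - f\<parallel> \<le> \<parallel>f\<parallel>\<^sub>\<infinity> \<parallel>L 1 - 1\<parallel> + A \<parallel>L 1\<parallel> + B \<mu>\<^sup>2\<close>. With \<open>\<omega> = \<omega>(f, \<delta>)\<close> one may take \<open>A = \<omega>\<close> and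
  \<open>B = \<omega>/\<delta>\<^sup>2\<close>; choose \<open>\<delta> = \<mu>\<close>, or let \<open>\<delta>\<close> tend to \<open>0\<close> if \<open>\<mu> = 0\<close>. For differentiable \<open>f\<close> and
  \<open>K = \<parallel>f'\<parallel>\<^sub>\<infinity>\<close>, AM-GM allows \<open>A = K\<epsilon>/2\<close> and \<open>B = K/(2\<epsilon>)\<close> for every \<open>\<epsilon> > 0\<close>; optimising
  \<open>\<epsilon>\<close> gives \<open>\<surd>c \<mu> K\<close>, so the term with \<open>\<omega>(f', \<mu>)\<close> is not even needed.
\<close>

section \<open>Continuous periodic functions and their modulus of continuity\<close>

text \<open>One shift \<open>n\<close> serves every \<open>z\<close>, so two points can be moved
  together without changing the values of \<open>f\<close>.\<close>

lemma C2pi_shift_to_interval: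
  assumes "f \<in> C2pi"
  obtains n :: int where "x + of_int n * (2 * pi) \<in> {y - pi..y + pi}"
    and "\<And>z. f (z + of_int n * (2 * pi)) = f z"
proof -
  interpret periodic_fun_simple f "2 * pi"
    using assms by unfold_locales (simp add: C2pi_def)
  \<comment> \<open>The floor counts the whole periods from \<open>y - pi\<close> to
    \<open>x\<close>.\<close>
  define n where "n = - \<lfloor>(x - y + pi) / (2 * pi)\<rfloor>"
  have "of_int (- n) \<le> (x - y + pi) / (2 * pi)" "(x - y + pi) / (2 * pi) < of_int (- n) + 1"
    unfolding n_def by linarith+
  then have "x + of_int n * (2 * pi) \<in> {y - pi..y + pi}"
    by (simp add: field_simps)
  with plus_of_int show thesis
    using that by blast
qed

lemma C2pi_bounded:
  assumes "f \<in> C2pi"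
  shows "bounded (range f)"
proof -
  have "range f \<subseteq> f ` {-pi..pi}"
  proof
    fix y assume "y \<in> range f"
    then obtain x where "y = f x" by blast
    then show "y \<in> f ` {-pi..pi}"
      using C2pi_shift_to_interval[OF assms, of x 0]
      by (smt (verit, best) add.left_neutral atLeastAtMost_iff imageI)
  qed
  moreover have "compact (f ` {-pi..pi})"
    using assms by (intro compact_continuous_image) (auto simp: C2pi_def intro: continuous_on_subset)
  ultimately show ?thesis
    using bounded_subset compact_imp_bounded by blast
qed

lemma abs_le_supnorm:
  assumes "f \<in> C2pi"
  shows "\<bar>f x\<bar> \<le> supnorm f"
  using C2pi_bounded[OF assms] unfolding supnorm_def bounded_iff
  by (intro cSUP_upper) (auto simp: bdd_above_def)

lemma supnorm_nonneg: "f \<in> C2pi \<Longrightarrow> 0 \<le> supnorm f"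
  using abs_le_supnorm[of f 0] by linarith

lemma abs_diff_le_modulus:
  assumes "f \<in> C2pi" "\<bar>x - y\<bar> \<le> \<delta>"
  shows "\<bar>f x - f y\<bar> \<le> modulus f \<delta>"
  unfolding modulus_def
proof (rule cSup_upper)
  \<comment> \<open>A real \<open>Sup\<close> is sure to dominate its elements only when the set is
    bounded above.\<close>
  have "\<bar>f u - f v\<bar> \<le> 2 * supnorm f" for u v
    using abs_le_supnorm[OF assms(1), of u] abs_le_supnorm[OF assms(1), of v] by linarith
  then show "bdd_above {\<bar>f x - f y\<bar> |x y. \<bar>x - y\<bar> \<le> \<delta>}"
    by (auto simp: bdd_above_def)
qed (use assms in blast)

lemma modulus_le:
  assumes "0 \<le> \<delta>" "\<And>x y. \<bar>x - y\<bar> \<le> \<delta> \<Longrightarrow> \<bar>f x - f y\<bar> \<le> m"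
  shows "modulus f \<delta> \<le> m"
  unfolding modulus_def
proof (rule cSup_least)
  \<comment> \<open>The least upper bound property needs a nonempty set; the pair (0, 0) is
    admissible since \<open>0 \<le> \<delta>\<close>.\<close>
  have "\<bar>f 0 - f 0\<bar> \<in> {\<bar>f x - f y\<bar> |x y. \<bar>x - y\<bar> \<le> \<delta>}"
    using assms(1) by (intro CollectI exI[of _ 0]) simp
  then show "{\<bar>f x - f y\<bar> |x y. \<bar>x - y\<bar> \<le> \<delta>} \<noteq> {}"
    by blast
qed (use assms in auto)

lemma modulus_nonneg: "f \<in> C2pi \<Longrightarrow> 0 \<le> \<delta> \<Longrightarrow> 0 \<le> modulus f \<delta>"
  using abs_diff_le_modulus[of f 0 0 \<delta>] by simp

text \<open>Uniform continuity on a compact interval is carried to the whole line by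
  periodicity.\<close>

lemma modulus_tendsto_0:
  assumes "f \<in> C2pi"
  shows "(modulus f \<longlongrightarrow> 0) (at_right 0)"
proof (rule tendstoI)
  fix e :: real assume "0 < e"
  \<comment> \<open>The margin 1 keeps \<open>y\<close> inside once \<open>x\<close> has been
    shifted into \<open>{-pi..pi}\<close>. The bound \<open>e / 2\<close> makes up for the
    strictness lost in the supremum.\<close>
  have "uniformly_continuous_on {-pi - 1..pi + 1} f"
    using assms by (intro compact_uniformly_continuous) (auto simp: C2pi_def intro: continuous_on_subset)
  then obtain d where "d > 0"
    and d: "\<And>x y. x \<in> {-pi - 1..pi + 1} \<Longrightarrow> y \<in> {-pi - 1..pi + 1} \<Longrightarrow> \<bar>y - x\<bar> < d \<Longrightarrow> \<bar>f y - f x\<bar> < e / 2"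
    unfolding uniformly_continuous_on_def dist_real_def using \<open>0 < e\<close> half_gt_zero by metis
  have "\<bar>modulus f t\<bar> < e" if t: "0 < t" "t < min d 1" for t
  proof -
    have "\<bar>f x - f y\<bar> \<le> e / 2" if "\<bar>x - y\<bar> \<le> t" for x y
    proof -
      obtain n :: int where n: "x + of_int n * (2 * pi) \<in> {0 - pi..0 + pi}"
        "\<And>z. f (z + of_int n * (2 * pi)) = f z"
        using C2pi_shift_to_interval[OF assms, of x 0] by blast
      have "\<bar>f (x + of_int n * (2 * pi)) - f (y + of_int n * (2 * pi))\<bar> < e / 2"
        using n(1) that t by (intro d) auto
      then show ?thesis
        by (simp only: n(2))
    qed
    then have "modulus f t \<le> e / 2"
      using t by (intro modulus_le) auto
    then show ?thesis
      using modulus_nonneg[OF assms, of t] t \<open>0 < e\<close> by simp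
  qed
  then show "\<forall>\<^sub>F t in at_right 0. dist (modulus f t) 0 < e"
    using \<open>d > 0\<close> by (auto simp: eventually_at_right_field intro: exI[of _ "min d 1"])
qed

text \<open>Cut the segment from \<open>x\<close> to \<open>y\<close> into \<open>k\<close> equal
  pieces, each no longer than \<delta>, and add up the increments.\<close>

lemma abs_diff_le_nat_mult_modulus:
  assumes "f \<in> C2pi" "0 \<le> \<delta>" "\<bar>x - y\<bar> \<le> of_nat k * \<delta>"
  shows "\<bar>f x - f y\<bar> \<le> of_nat k * modulus f \<delta>"
  using assms(3)
proof (induction k arbitrary: x)
  case 0
  then show ?case by simp
next
  case (Suc k)
  \<comment> \<open>\<open>z\<close> is the first division point; the rest of the segment is
    \<open>k\<close> pieces of the same length, which the induction hypothesis covers.\<close>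
  define z where "z = x + (y - x) / of_nat (Suc k)"
  have "\<bar>x - z\<bar> = \<bar>x - y\<bar> / of_nat (Suc k)"
    by (simp add: z_def abs_minus_commute)
  also have "\<dots> \<le> \<delta>"
    using Suc.prems by (simp add: divide_le_eq mult.commute del: of_nat_Suc)
  finally have xz: "\<bar>x - z\<bar> \<le> \<delta>" .
  have "z - y = of_nat k * ((x - y) / of_nat (Suc k))"
    by (simp add: z_def field_simps)
  then have "\<bar>z - y\<bar> = of_nat k * (\<bar>x - y\<bar> / of_nat (Suc k))"
    by (simp add: abs_mult)
  also have "\<dots> \<le> of_nat k * \<delta>"
    using Suc.prems by (intro mult_left_mono) (simp_all add: divide_le_eq mult.commute del: of_nat_Suc)
  finally have "\<bar>f z - f y\<bar> \<le> of_nat k * modulus f \<delta>"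
    by (rule Suc.IH)
  with abs_diff_le_modulus[OF assms(1) xz] show ?case
    by (simp add: algebra_simps)
qed

text \<open>For distance q \<delta> with q \<ge> 1, the number of steps is at most 1 + q, hence at
  most 1 + q^2. The square is what the trigonometric moment can control.\<close>

lemma abs_diff_le_modulus_square:
  assumes "f \<in> C2pi" "0 < \<delta>"
  shows "\<bar>f x - f y\<bar> \<le> (1 + (x - y)\<^sup>2 / \<delta>\<^sup>2) * modulus f \<delta>"
proof (cases "\<bar>x - y\<bar> \<le> \<delta>")
  case True
  have "modulus f \<delta> * 1 \<le> modulus f \<delta> * (1 + (x - y)\<^sup>2 / \<delta>\<^sup>2)"
    using modulus_nonneg[OF assms(1)] assms(2) by (intro mult_left_mono) simp_all
  then show ?thesis
    using abs_diff_le_modulus[OF assms(1) True] by (simp add: mult.commute)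
next
  case False
  define q where "q = \<bar>x - y\<bar> / \<delta>"
  have q: "1 \<le> q" using False assms(2) by (simp add: q_def)
  define k where "k = nat \<lceil>q\<rceil>"
  have k: "q \<le> of_nat k" "of_nat k \<le> 1 + q"
    using q unfolding k_def by linarith+
  have "\<bar>f x - f y\<bar> \<le> of_nat k * modulus f \<delta>"
    using k(1) assms by (intro abs_diff_le_nat_mult_modulus) (auto simp: q_def divide_le_eq)
  also have "\<dots> \<le> (1 + q\<^sup>2) * modulus f \<delta>"
  proof (rule mult_right_mono)
    have "q * 1 \<le> q * q"
      using q by (intro mult_left_mono) auto
    with k(2) show "of_nat k \<le> 1 + q\<^sup>2"
      by (simp add: power2_eq_square)
  qed (use modulus_nonneg[OF assms(1)] assms(2) in simp)
  finally show ?thesis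
    by (simp add: q_def power_divide)
qed

section \<open>From squared distances to trigonometric functions\<close>

text \<open>Jordan's inequality: a concave function lies above its chord, here the one joining 0 and
  \<open>pi / 2\<close>.\<close>

lemma sin_ge_two_over_pi:
  fixes x :: real
  assumes "0 \<le> x" "x \<le> pi / 2"
  shows "2 / pi * x \<le> sin x"
proof -
  have "concave_on {0..pi} (sin :: real \<Rightarrow> real)"
    by (rule f''_le0_imp_concave[where f' = cos and f'' = "\<lambda>x. - sin x"])
      (auto intro!: derivative_eq_intros sin_ge_zero)
  \<comment> \<open>\<open>x\<close> is the convex combination of 0 and \<open>pi / 2\<close> with
    weight \<open>2 / pi * x\<close> on the latter.\<close>
  from concave_onD[OF this, of "2 / pi * x" 0 "pi / 2"] show ?thesis
    using assms by (simp add: field_simps)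
qed

text \<open>Jordan's inequality at \<open>\<bar>u\<bar> / 2\<close>, squared, with the squared sine
  rewritten by the half-angle formula.\<close>

lemma square_le_pi_square_sin_half:
  assumes "\<bar>u\<bar> \<le> pi"
  shows "u\<^sup>2 \<le> pi\<^sup>2 * ((1 - cos u) / 2)"
proof -
  have "\<bar>u\<bar> \<le> pi * sin (\<bar>u\<bar> / 2)"
    using sin_ge_two_over_pi[of "\<bar>u\<bar> / 2"] assms by (simp add: field_simps)
  then have "\<bar>u\<bar>\<^sup>2 \<le> (pi * sin (\<bar>u\<bar> / 2))\<^sup>2"
    by (intro power_mono) auto
  also have "\<dots> = pi\<^sup>2 * ((1 - cos \<bar>u\<bar>) / 2)"
    using cos_double_sin[of "\<bar>u\<bar> / 2"] by (simp add: power_mult_distrib)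
  finally show ?thesis
    by simp
qed

text \<open>Moving \<open>x\<close> by whole periods to within \<open>pi\<close> of \<open>y\<close>
  changes neither \<open>f\<close> nor the cosine. For fixed \<open>y\<close> the resulting majorant
  is a combination of 1, \<open>cos\<close> and \<open>sin\<close> in \<open>x\<close>, so a linear
  operator can be applied to it.\<close>

lemma C2pi_diff_le_cos:
  assumes "f \<in> C2pi" "0 \<le> B"
    and "\<And>x y. \<bar>f x - f y\<bar> \<le> A + B * (x - y)\<^sup>2"
  shows "\<bar>f x - f y\<bar> \<le> A + B * pi\<^sup>2 * ((1 - (cos y * cos x + sin y * sin x)) / 2)"
proof -
  obtain n :: int where n: "x + of_int n * (2 * pi) \<in> {y - pi..y + pi}"
    "\<And>z. f (z + of_int n * (2 * pi)) = f z"
    using C2pi_shift_to_interval[OF assms(1), of x y] by blast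
  define x' where "x' = x + of_int n * (2 * pi)"
  have "\<bar>f x - f y\<bar> = \<bar>f x' - f y\<bar>"
    by (simp add: x'_def n(2))
  also have "\<dots> \<le> A + B * (x' - y)\<^sup>2"
    by (rule assms(3))
  also have "\<dots> \<le> A + B * (pi\<^sup>2 * ((1 - cos (x' - y)) / 2))"
    using n(1) assms(2) unfolding x'_def
    by (intro add_left_mono mult_left_mono square_le_pi_square_sin_half) auto
  also have "cos (x' - y) = cos (x - y)"
    using cos.plus_of_int[of "x - y" n] by (simp add: x'_def algebra_simps)
  finally show ?thesis
    by (simp add: cos_diff mult_ac)
qed

lemma abs_diff_le_supnorm_deriv:
  assumes "f' \<in> C2pi" "\<And>x. (f has_real_derivative f' x) (at x)"
  shows "\<bar>f x - f y\<bar> \<le> supnorm f' * \<bar>x - y\<bar>"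
  using field_differentiable_bound[of UNIV f f' "supnorm f'" x y] assms abs_le_supnorm[OF assms(1)]
  by simp

section \<open>The function norm and the embedding of continuous periodic functions\<close>

lemma measurable_leb_pi: "f \<in> borel_measurable borel \<Longrightarrow> f \<in> borel_measurable leb_pi"
  for f :: "real \<Rightarrow> real"
  unfolding leb_pi_def by (intro measurable_restrict_space1) simp

lemma AE_leb_pi_iff: "(AE x in leb_pi. P x) \<longleftrightarrow> (AE x in lborel. x \<in> {-pi..pi} \<longrightarrow> P x)"
  unfolding leb_pi_def by (rule AE_restrict_space_iff) simp

text \<open>Monotonicity, subadditivity and homogeneity of \<open>\<rho>\<close> in one rule. The
  absolute values on the right put the majorant into \<open>Mplus\<close>.\<close>

lemma Xnorm_le_lincomb:
  assumes \<rho>: "function_norm \<rho>"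
    and [measurable]: "h \<in> borel_measurable leb_pi" "f \<in> borel_measurable leb_pi" "g \<in> borel_measurable leb_pi"
    and ab: "0 \<le> a" "0 \<le> b"
    and le: "AE x in leb_pi. \<bar>h x\<bar> \<le> a * \<bar>f x\<bar> + b * \<bar>g x\<bar>"
  shows "Xnorm \<rho> h \<le> ennreal a * Xnorm \<rho> f + ennreal b * Xnorm \<rho> g"
proof -
  have M: "(\<lambda>x. \<bar>h x\<bar>) \<in> Mplus" "(\<lambda>x. \<bar>f x\<bar>) \<in> Mplus" "(\<lambda>x. \<bar>g x\<bar>) \<in> Mplus"
    "(\<lambda>x. a * \<bar>f x\<bar>) \<in> Mplus" "(\<lambda>x. b * \<bar>g x\<bar>) \<in> Mplus"
    "(\<lambda>x. a * \<bar>f x\<bar> + b * \<bar>g x\<bar>) \<in> Mplus"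
    using ab by (auto simp: Mplus_def)
  have mono: "\<forall>f\<in>Mplus. \<forall>g\<in>Mplus. (AE x in leb_pi. g x \<le> f x) \<longrightarrow> \<rho> g \<le> \<rho> f"
    and add: "\<forall>f\<in>Mplus. \<forall>g\<in>Mplus. \<rho> (\<lambda>x. f x + g x) \<le> \<rho> f + \<rho> g"
    and scale: "\<forall>f\<in>Mplus. \<forall>a\<ge>0. \<rho> (\<lambda>x. a * f x) = ennreal a * \<rho> f"
    using \<rho> unfolding function_norm_def by simp_all
  have "\<rho> (\<lambda>x. \<bar>h x\<bar>) \<le> \<rho> (\<lambda>x. a * \<bar>f x\<bar> + b * \<bar>g x\<bar>)"
    using mono[rule_format, OF M(6) M(1) le] .
  also have "\<dots> \<le> \<rho> (\<lambda>x. a * \<bar>f x\<bar>) + \<rho> (\<lambda>x. b * \<bar>g x\<bar>)"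
    using add[rule_format, OF M(4) M(5)] .
  finally show ?thesis
    unfolding Xnorm_def scale[rule_format, OF M(2) ab(1)] scale[rule_format, OF M(3) ab(2)] .
qed

lemma Xnorm_eq_0:
  assumes "function_norm \<rho>" "f \<in> borel_measurable leb_pi" "AE x in leb_pi. f x = 0"
  shows "Xnorm \<rho> f = 0"
proof -
  have "(\<lambda>x. \<bar>f x\<bar>) \<in> Mplus"
    using assms(2) by (simp add: Mplus_def)
  then show ?thesis
    using assms(1,3) by (simp add: function_norm_def Xnorm_def)
qed

lemma C2pi_measurable: "f \<in> C2pi \<Longrightarrow> f \<in> borel_measurable borel"
  unfolding C2pi_def by (auto intro: borel_measurable_continuous_onI)

text \<open>Where \<open>x + \<delta>\<close> stays in the interval, the difference is at most the
  modulus, which tends to 0. On the remaining strip it is at most \<open>supnorm f\<close>, and the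
  norm of the strip tends to 0 because 1 has absolutely continuous norm.\<close>

lemma C2pi_shift_continuous:
  assumes \<rho>: "function_norm \<rho>" and one: "(\<lambda>_. 1) \<in> Xa \<rho>" and f: "f \<in> C2pi"
  shows "f \<in> shift_continuous \<rho>"
proof -
  note [measurable] = C2pi_measurable[OF f]
  have fin: "Xnorm \<rho> (\<lambda>_. 1) < \<infinity>"
    using one by (simp add: Xa_def Xspace_def)
  have "Xnorm \<rho> f \<le> ennreal (supnorm f) * Xnorm \<rho> (\<lambda>_. 1) + ennreal 0 * Xnorm \<rho> (\<lambda>_. 1)"
    using abs_le_supnorm[OF f] supnorm_nonneg[OF f] by (intro Xnorm_le_lincomb[OF \<rho>] measurable_leb_pi) auto
  also have "\<dots> < \<infinity>"
    using fin by (simp add: ennreal_mult_less_top)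
  finally have "f \<in> Xspace \<rho>"
    by (simp add: Xspace_def measurable_leb_pi)
  moreover have "((\<lambda>\<delta>. Xnorm \<rho> (\<lambda>x. translate \<delta> f x - f x)) \<longlongrightarrow> 0) (at_right 0)"
  \<comment> \<open>Absolute continuity of the norm speaks of sequences of sets, hence the passage
    to sequences of shifts.\<close>
  proof (rule tendsto_at_right_sequentially[of 0 1])
    fix S :: "nat \<Rightarrow> real"
    assume S: "\<And>n. 0 < S n" "S \<longlonglongrightarrow> 0"
    define E where "E n = {x \<in> {-pi..pi}. pi < x + S n}" for n
    have E: "E n \<in> sets leb_pi" for n
      unfolding E_def leb_pi_def by (subst sets_restrict_space_iff) auto
    have "AE x in leb_pi. (\<lambda>n. indicator (E n) x :: real) \<longlonglongrightarrow> 0"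
      \<comment> \<open>The endpoint \<open>pi\<close> lies in every strip \<open>E n\<close>; any
        other point of the interval eventually leaves them.\<close>
      unfolding AE_leb_pi_iff using AE_lborel_singleton[of pi]
    proof eventually_elim
      case (elim x)
      show ?case
      proof
        assume "x \<in> {-pi..pi}"
        with elim have "0 < pi - x" by simp
        then have "\<forall>\<^sub>F n in sequentially. S n < pi - x"
          by (rule order_tendstoD(2)[OF S(2)])
        then have "\<forall>\<^sub>F n in sequentially. indicator (E n) x = (0 :: real)"
          by eventually_elim (auto simp: E_def indicator_def)
        then show "(\<lambda>n. indicator (E n) x :: real) \<longlonglongrightarrow> 0"
          by (rule tendsto_eventually)
      qed
    qed
    with one E have lim_E: "(\<lambda>n. Xnorm \<rho> (\<lambda>x. 1 * indicator (E n) x)) \<longlonglongrightarrow> 0"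
      unfolding Xa_def by blast
    have "filterlim S (at_right 0) sequentially"
      using S by (intro tendsto_imp_filterlim_at_right) auto
    then have lim_mod: "(\<lambda>n. modulus f (S n)) \<longlonglongrightarrow> 0"
      by (rule filterlim_compose[OF modulus_tendsto_0[OF f]])
    have le: "Xnorm \<rho> (\<lambda>x. translate (S n) f x - f x)
        \<le> ennreal (modulus f (S n)) * Xnorm \<rho> (\<lambda>_. 1)
          + ennreal (supnorm f) * Xnorm \<rho> (\<lambda>x. 1 * indicator (E n) x)" for n
    proof (intro Xnorm_le_lincomb[OF \<rho>] AE_I2)
      show "(\<lambda>x. translate (S n) f x - f x) \<in> borel_measurable leb_pi"
        unfolding translate_def by (rule measurable_leb_pi) measurable
      show "(\<lambda>x. 1 * indicator (E n) x :: real) \<in> borel_measurable leb_pi"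
        using E by simp
      fix x assume "x \<in> space leb_pi"
      then have x: "x \<in> {-pi..pi}"
        by (simp add: leb_pi_def)
      have "0 \<le> modulus f (S n)"
        using S(1)[of n] by (intro modulus_nonneg[OF f]) simp
      moreover have "\<bar>f (x + S n) - f x\<bar> \<le> modulus f (S n)"
        using S(1)[of n] by (intro abs_diff_le_modulus[OF f]) simp
      ultimately show "\<bar>translate (S n) f x - f x\<bar>
          \<le> modulus f (S n) * \<bar>1\<bar> + supnorm f * \<bar>1 * indicator (E n) x\<bar>"
        using x S(1)[of n] abs_le_supnorm[OF f, of x]
        by (auto simp: translate_def E_def indicator_def)
    qed (use less_imp_le[OF S(1)[of n]] f in \<open>auto intro: modulus_nonneg supnorm_nonneg\<close>)
    have "(\<lambda>n. ennreal (modulus f (S n)) * Xnorm \<rho> (\<lambda>_. 1)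
          + ennreal (supnorm f) * Xnorm \<rho> (\<lambda>x. 1 * indicator (E n) x))
        \<longlonglongrightarrow> ennreal 0 * Xnorm \<rho> (\<lambda>_. 1) + ennreal (supnorm f) * 0"
      \<comment> \<open>Multiplication on \<open>ennreal\<close> is discontinuous at 0 times
        infinity, so the limit of the product relies on the finite norm of 1.\<close>
      using fin by (intro tendsto_intros lim_mod lim_E) auto
    then have lim: "(\<lambda>n. ennreal (modulus f (S n)) * Xnorm \<rho> (\<lambda>_. 1)
          + ennreal (supnorm f) * Xnorm \<rho> (\<lambda>x. 1 * indicator (E n) x)) \<longlonglongrightarrow> 0"
      by simp
    show "(\<lambda>n. Xnorm \<rho> (\<lambda>x. translate (S n) f x - f x)) \<longlonglongrightarrow> 0"
      by (rule tendsto_sandwich[OF _ _ tendsto_const lim]) (use le in simp_all)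
  qed simp
  ultimately show ?thesis
    by (simp add: shift_continuous_def)
qed

text \<open>A shift continuous function is its own approximant in the closure. This makes the
  operator hypotheses available on \<open>C2pi\<close>.\<close>

lemma C2pi_subset_XS2pi:
  assumes "function_norm \<rho>" "(\<lambda>_. 1) \<in> Xa \<rho>"
  shows "C2pi \<subseteq> XS2pi \<rho>"
proof
  fix f assume f: "f \<in> C2pi"
  have g: "f \<in> shift_continuous \<rho>"
    by (rule C2pi_shift_continuous[OF assms f])
  have "Xnorm \<rho> (\<lambda>x. f x - f x) = 0"
    using assms(1) by (intro Xnorm_eq_0) auto
  with g have "f \<in> XS \<rho>"
    unfolding XS_def by (auto simp: shift_continuous_def intro!: bexI[of _ f])
  then show "f \<in> XS2pi \<rho>"
    using f C2pi_measurable[OF f] by (simp add: XS2pi_def C2pi_def)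
qed

section \<open>Linear and positive operators on combinations of 1, \<open>cos\<close>,
  \<open>sin\<close> and \<open>f\<close>\<close>

lemma C2pi_lincomb: "f \<in> C2pi \<Longrightarrow> g \<in> C2pi \<Longrightarrow> (\<lambda>t. a * f t + b * g t) \<in> C2pi"
  unfolding C2pi_def by (auto intro!: continuous_intros)

lemma C2pi_const: "(\<lambda>_. a) \<in> C2pi"
  by (simp add: C2pi_def)

lemma C2pi_cos: "cos \<in> C2pi"
  by (simp add: C2pi_def continuous_on_cos continuous_on_id)

lemma C2pi_sin: "sin \<in> C2pi"
  by (simp add: C2pi_def continuous_on_sin continuous_on_id)

lemma linear_operator_lincomb:
  assumes \<rho>: "function_norm \<rho>" "(\<lambda>_. 1) \<in> Xa \<rho>"
    and L: "linear_operator \<rho> L" and f: "f \<in> C2pi" and g: "g \<in> C2pi"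
  shows "AE x in lborel. L (\<lambda>t. a * f t + b * g t) x = a * L f x + b * L g x"
proof -
  have "(\<lambda>t. a * f t) \<in> C2pi" "(\<lambda>t. b * g t) \<in> C2pi"
    using C2pi_lincomb[OF f f, of a 0] C2pi_lincomb[OF g g, of b 0] by simp_all
  then have X: "(\<lambda>t. a * f t) \<in> XS2pi \<rho>" "(\<lambda>t. b * g t) \<in> XS2pi \<rho>" "f \<in> XS2pi \<rho>" "g \<in> XS2pi \<rho>"
    using C2pi_subset_XS2pi[OF \<rho>] f g by auto
  have add: "\<forall>f\<in>XS2pi \<rho>. \<forall>g\<in>XS2pi \<rho>. AE x in lborel. L (\<lambda>t. f t + g t) x = L f x + L g x"
    and scale: "\<forall>f\<in>XS2pi \<rho>. \<forall>a. AE x in lborel. L (\<lambda>t. a * f t) x = a * L f x"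
    using L unfolding linear_operator_def by simp_all
  have "AE x in lborel. L (\<lambda>t. a * f t + b * g t) x = L (\<lambda>t. a * f t) x + L (\<lambda>t. b * g t) x"
    "AE x in lborel. L (\<lambda>t. a * f t) x = a * L f x"
    "AE x in lborel. L (\<lambda>t. b * g t) x = b * L g x"
    using add[rule_format, OF X(1,2)] scale[rule_format, OF X(3)] scale[rule_format, OF X(4)] by simp_all
  then show ?thesis
    by eventually_elim simp
qed

lemma linear_operator_measurable:
  assumes "function_norm \<rho>" "(\<lambda>_. 1) \<in> Xa \<rho>" "linear_operator \<rho> L" "f \<in> C2pi"
  shows "L f \<in> borel_measurable borel"
proof -
  have "L f \<in> XS2pi \<rho>"
    using assms C2pi_subset_XS2pi[OF assms(1,2)] unfolding linear_operator_def by blast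
  then show ?thesis
    by (simp add: XS2pi_def)
qed

text \<open>With \<open>y\<close> fixed, the upper and the lower estimate of
  \<open>f t - f y\<close> both take this four-term form in \<open>t\<close>.\<close>

lemma positive_operator_lincomb_nonneg:
  assumes \<rho>: "function_norm \<rho>" "(\<lambda>_. 1) \<in> Xa \<rho>"
    and L: "linear_operator \<rho> L" "positive_operator \<rho> L" and f: "f \<in> C2pi"
    and nonneg: "\<And>t. 0 \<le> a + p * cos t + q * sin t + r * f t"
  shows "AE x in lborel. 0 \<le> a * L (\<lambda>_. 1) x + p * L cos x + q * L sin x + r * L f x"
proof -
  note lin = linear_operator_lincomb[OF \<rho> L(1)]
  define u where "u = (\<lambda>t. a * 1 + p * cos t)"
  define v where "v = (\<lambda>t. q * sin t + r * f t)"
  have uv: "u \<in> C2pi" "v \<in> C2pi"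
    unfolding u_def v_def by (rule C2pi_lincomb[OF C2pi_const C2pi_cos], rule C2pi_lincomb[OF C2pi_sin f])
  \<comment> \<open>The factors 1 give the sum the shape of the two-term linearity rule, which is
    thus used three times.\<close>
  then have w: "(\<lambda>t. 1 * u t + 1 * v t) \<in> XS2pi \<rho>"
    using C2pi_subset_XS2pi[OF \<rho>] C2pi_lincomb by blast
  have "0 \<le> 1 * u t + 1 * v t" for t
    using nonneg[of t] by (simp add: u_def v_def)
  then have "AE x in lborel. 0 \<le> L (\<lambda>t. 1 * u t + 1 * v t) x"
    using L(2)[unfolded positive_operator_def, rule_format, OF w] by simp
  moreover have "AE x in lborel. L (\<lambda>t. 1 * u t + 1 * v t) x = 1 * L u x + 1 * L v x"
    using uv by (rule lin)
  moreover have "AE x in lborel. L u x = a * L (\<lambda>_. 1) x + p * L cos x"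
    unfolding u_def by (rule lin[OF C2pi_const C2pi_cos])
  moreover have "AE x in lborel. L v x = q * L sin x + r * L f x"
    unfolding v_def by (rule lin[OF C2pi_sin f])
  ultimately show ?thesis
    by eventually_elim simp
qed

text \<open>
  Positivity gives the bound with \<open>f x\<close> replaced by \<open>f y\<close> for a fixed \<open>y\<close>, outside a null set that
  depends on \<open>y\<close>. Letting \<open>y\<close> range over the rationals keeps the exceptional set null, and both
  sides are continuous in \<open>y\<close>, so \<open>y = x\<close> is allowed.
\<close>

lemma positive_operator_pointwise_bound:
  assumes \<rho>: "function_norm \<rho>" "(\<lambda>_. 1) \<in> Xa \<rho>"
    and L: "linear_operator \<rho> L" "positive_operator \<rho> L" and f: "f \<in> C2pi"
    and bound: "\<And>t y. \<bar>f t - f y\<bar> \<le> A + B * ((1 - (cos y * cos t + sin y * sin t)) / 2)"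
  shows "AE x in lborel. \<bar>L f x - f x * L (\<lambda>_. 1) x\<bar> \<le> A * L (\<lambda>_. 1) x + B * sin2_moment L x"
proof -
  \<comment> \<open>\<open>G x y\<close> is the slack in the estimate with \<open>y\<close> in the
    coefficients; \<open>G x x \<ge> 0\<close> is the claim.\<close>
  define G where "G x y = A * L (\<lambda>_. 1) x
    + B * (1/2 * (L (\<lambda>_. 1) x - cos y * L cos x - sin y * L sin x))
    - \<bar>L f x - f y * L (\<lambda>_. 1) x\<bar>" for x y
  have "AE x in lborel. \<forall>y\<in>\<rat>. 0 \<le> G x y"
  proof (subst AE_ball_countable[OF countable_rat], intro ballI)
    fix y :: real
    \<comment> \<open>The two halves of the absolute value bound, sorted by 1, \<open>cos t\<close>,
      \<open>sin t\<close> and \<open>f t\<close>.\<close>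
    have "0 \<le> (A + B/2 + f y) + (- B/2 * cos y) * cos t + (- B/2 * sin y) * sin t + (-1) * f t"
      "0 \<le> (A + B/2 - f y) + (- B/2 * cos y) * cos t + (- B/2 * sin y) * sin t + 1 * f t" for t
      using bound[of t y] unfolding abs_le_iff by (simp_all add: field_simps)
    note this[THEN positive_operator_lincomb_nonneg[OF \<rho> L f]]
    then show "AE x in lborel. 0 \<le> G x y"
      by eventually_elim (unfold G_def diff_ge_0_iff_ge abs_le_iff, simp add: field_simps)
  qed
  then show ?thesis
  proof eventually_elim
    case (elim x)
    have "continuous_on (closure \<rat>) (G x)"
      using f unfolding G_def C2pi_def Rats_closure_real by (auto intro!: continuous_intros)
    with elim have "0 \<le> G x x"
      using continuous_ge_on_closure[of \<rat> "G x" x 0] by (simp add: Rats_closure_real)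
    then show ?case
      by (simp add: G_def sin2_moment_def)
  qed
qed

text \<open>Split L f - f into f (L 1 - 1) and L f - f L 1; the pointwise estimate controls the
  second part.\<close>

lemma positive_operator_norm_bound:
  assumes \<rho>: "function_norm \<rho>" "(\<lambda>_. 1) \<in> Xa \<rho>"
    and L: "linear_operator \<rho> L" "positive_operator \<rho> L" and f: "f \<in> C2pi"
    and AB: "0 \<le> A" "0 \<le> B"
    and bound: "\<And>x y. \<bar>f x - f y\<bar> \<le> A + B * (x - y)\<^sup>2"
  shows "Xnorm \<rho> (\<lambda>x. L f x - f x)
    \<le> ennreal (supnorm f) * Xnorm \<rho> (\<lambda>x. L (\<lambda>_. 1) x - 1)
      + (ennreal A * Xnorm \<rho> (L (\<lambda>_. 1)) + ennreal B * (ennreal (pi\<^sup>2) * Xnorm \<rho> (sin2_moment L)))"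
proof -
  note meas = linear_operator_measurable[OF \<rho> L(1)]
  note [measurable] = C2pi_measurable[OF f] meas[OF f] meas[OF C2pi_const] meas[OF C2pi_sin] meas[OF C2pi_cos]
  have [measurable]: "sin2_moment L \<in> borel_measurable borel"
    unfolding sin2_moment_def by measurable
  \<comment> \<open>The norm rule handles two terms at a time, so the last two of the three are
    first bundled into \<open>h\<close>.\<close>
  define h where "h x = A * \<bar>L (\<lambda>_. 1) x\<bar> + B * pi\<^sup>2 * \<bar>sin2_moment L x\<bar>" for x
  have h_nonneg: "0 \<le> h x" for x
    using AB by (simp add: h_def)
  have [measurable]: "h \<in> borel_measurable borel"
    unfolding h_def by measurable
  have "AE x in lborel. \<bar>L f x - f x * L (\<lambda>_. 1) x\<bar> \<le> A * L (\<lambda>_. 1) x + B * pi\<^sup>2 * sin2_moment L x"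
    using C2pi_diff_le_cos[OF f AB(2) bound] by (rule positive_operator_pointwise_bound[OF \<rho> L f])
  then have *: "AE x in lborel. \<bar>L f x - f x\<bar> \<le> supnorm f * \<bar>L (\<lambda>_. 1) x - 1\<bar> + 1 * \<bar>h x\<bar>"
  proof eventually_elim
    case (elim x)
    have "\<bar>L f x - f x\<bar> \<le> \<bar>f x * (L (\<lambda>_. 1) x - 1)\<bar> + \<bar>L f x - f x * L (\<lambda>_. 1) x\<bar>"
      by (simp add: algebra_simps)
    also have "\<bar>f x * (L (\<lambda>_. 1) x - 1)\<bar> \<le> supnorm f * \<bar>L (\<lambda>_. 1) x - 1\<bar>"
      unfolding abs_mult by (intro mult_right_mono abs_le_supnorm[OF f]) simp
    also have "\<bar>L f x - f x * L (\<lambda>_. 1) x\<bar> \<le> 1 * \<bar>h x\<bar>"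
      using elim AB mult_left_mono[OF abs_ge_self, of A "L (\<lambda>_. 1) x"]
        mult_left_mono[OF abs_ge_self, of "B * pi\<^sup>2" "sin2_moment L x"] h_nonneg[of x]
      by (simp add: h_def)
    finally show ?case by simp
  qed
  have "Xnorm \<rho> (\<lambda>x. L f x - f x)
      \<le> ennreal (supnorm f) * Xnorm \<rho> (\<lambda>x. L (\<lambda>_. 1) x - 1) + ennreal 1 * Xnorm \<rho> h"
    using * supnorm_nonneg[OF f] by (intro Xnorm_le_lincomb[OF \<rho>(1)] measurable_leb_pi) (auto simp: AE_leb_pi_iff)
  also have "Xnorm \<rho> h \<le> ennreal A * Xnorm \<rho> (L (\<lambda>_. 1)) + ennreal (B * pi\<^sup>2) * Xnorm \<rho> (sin2_moment L)"
    using AB h_nonneg by (intro Xnorm_le_lincomb[OF \<rho>(1)] measurable_leb_pi) (auto simp: h_def)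
  finally show ?thesis
    using AB by (simp add: ennreal_mult mult.assoc add_mono)
qed

section \<open>The error estimates for continuous and for differentiable functions\<close>

lemma modulus_error_bound:
  assumes \<rho>: "function_norm \<rho>" "(\<lambda>_. 1) \<in> Xa \<rho>"
    and L: "linear_operator \<rho> L" "positive_operator \<rho> L" and f: "f \<in> C2pi"
    and fin: "Xnorm \<rho> (L (\<lambda>_. 1)) < \<infinity>"
    and \<mu>: "0 \<le> \<mu>" "ennreal (\<mu>\<^sup>2) = ennreal (pi\<^sup>2) * Xnorm \<rho> (sin2_moment L)"
  shows "Xnorm \<rho> (\<lambda>x. L f x - f x)
    \<le> ennreal (supnorm f) * Xnorm \<rho> (\<lambda>x. L (\<lambda>_. 1) x - 1)
      + (Xnorm \<rho> (L (\<lambda>_. 1)) + 1) * ennreal (modulus f \<mu>)"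
    (is "?N \<le> ?S + (?N1 + 1) * _")
proof -
  have bound: "?N \<le> ?S + (ennreal (modulus f \<delta>) * ?N1 + ennreal (modulus f \<delta> / \<delta>\<^sup>2) * ennreal (\<mu>\<^sup>2))"
    if "0 < \<delta>" for \<delta>
    unfolding \<mu>(2)
  proof (rule positive_operator_norm_bound[OF \<rho> L f])
    show "\<bar>f x - f y\<bar> \<le> modulus f \<delta> + modulus f \<delta> / \<delta>\<^sup>2 * (x - y)\<^sup>2" for x y
      using abs_diff_le_modulus_square[OF f that, of x y] by (simp add: algebra_simps)
  qed (use modulus_nonneg[OF f] that in auto)
  show ?thesis
  proof (cases "\<mu> = 0")
    case False
    with \<mu>(1) have "0 < \<mu>" by simp
    have "ennreal (modulus f \<mu> / \<mu>\<^sup>2) * ennreal (\<mu>\<^sup>2) = ennreal (modulus f \<mu>)"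
      using \<open>0 < \<mu>\<close> modulus_nonneg[OF f \<mu>(1)] by (simp flip: ennreal_mult)
    with bound[OF \<open>0 < \<mu>\<close>] show ?thesis
      by (simp add: algebra_simps)
  next
    \<comment> \<open>Now the term with \<open>\<delta>\<^sup>2\<close> in the denominator is 0 for
      every \<delta>, and \<open>fin\<close> lets the other one vanish in the limit.\<close>
    case True
    have "((\<lambda>\<delta>. ?S + ennreal (modulus f \<delta>) * ?N1) \<longlongrightarrow> ?S + ennreal 0 * ?N1) (at_right 0)"
      using fin by (intro tendsto_intros modulus_tendsto_0[OF f]) auto
    moreover have "\<forall>\<^sub>F \<delta> in at_right 0. ?N \<le> ?S + ennreal (modulus f \<delta>) * ?N1"
      using eventually_at_right_less[of "0 :: real"]
      by eventually_elim (use bound True in simp)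
    ultimately have "?N \<le> ?S + ennreal 0 * ?N1"
      by (rule tendsto_lowerbound) simp
    then show ?thesis
      by (simp add: add_increasing2)
  qed
qed

lemma derivative_error_bound:
  assumes \<rho>: "function_norm \<rho>" "(\<lambda>_. 1) \<in> Xa \<rho>"
    and L: "linear_operator \<rho> L" "positive_operator \<rho> L" and f: "f \<in> C2pi" "f' \<in> C2pi"
    and deriv: "\<And>x. (f has_real_derivative f' x) (at x)"
    and c: "0 \<le> c" "Xnorm \<rho> (L (\<lambda>_. 1)) \<le> ennreal c"
    and \<mu>: "0 \<le> \<mu>" "ennreal (\<mu>\<^sup>2) = ennreal (pi\<^sup>2) * Xnorm \<rho> (sin2_moment L)"
  shows "Xnorm \<rho> (\<lambda>x. L f x - f x)
    \<le> ennreal (supnorm f) * Xnorm \<rho> (\<lambda>x. L (\<lambda>_. 1) x - 1) + ennreal (sqrt c * \<mu> * supnorm f')"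
    (is "?N \<le> ?S + _")
proof -
  define K where "K = supnorm f'"
  have K: "0 \<le> K"
    using supnorm_nonneg[OF f(2)] by (simp add: K_def)
  have bound: "?N \<le> ?S + ennreal (K * ((sqrt c + \<eta>) * (\<mu> + \<eta>)))" if "0 < \<eta>" for \<eta>
  proof -
    \<comment> \<open>The optimal \<epsilon> would be \<open>\<mu> / sqrt c\<close>, which may be
      undefined or 0. Adding \<eta> makes both quantities positive; \<eta> tends to 0 at the
      end.\<close>
    define a b where "a = sqrt c + \<eta>" and "b = \<mu> + \<eta>"
    have ab: "0 < a" "0 < b" "c \<le> a\<^sup>2" "\<mu>\<^sup>2 \<le> b\<^sup>2"
      using that c(1) \<mu>(1) power_mono[of "sqrt c" a 2] by (auto simp: a_def b_def add_nonneg_pos)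
    \<comment> \<open>This minimises \<open>K * \<epsilon> / 2 * a\<^sup>2 + K / (2 * \<epsilon>) *
      b\<^sup>2\<close>, making both summands equal to \<open>K * (a * b) / 2\<close>.\<close>
    define \<epsilon> where "\<epsilon> = b / a"
    have \<epsilon>: "0 < \<epsilon>"
      using ab by (simp add: \<epsilon>_def)
    have "?N \<le> ?S + (ennreal (K * \<epsilon> / 2) * Xnorm \<rho> (L (\<lambda>_. 1)) + ennreal (K / (2 * \<epsilon>)) * ennreal (\<mu>\<^sup>2))"
      unfolding \<mu>(2)
    proof (rule positive_operator_norm_bound[OF \<rho> L f(1)])
      fix x y
      have "0 \<le> (\<epsilon> - \<bar>x - y\<bar>)\<^sup>2 / (2 * \<epsilon>)"
        using \<epsilon> by simp
      also have "\<dots> = \<epsilon> / 2 + (x - y)\<^sup>2 / (2 * \<epsilon>) - \<bar>x - y\<bar>"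
        using \<epsilon> by (simp add: power2_diff field_simps power2_eq_square)
      finally have "K * \<bar>x - y\<bar> \<le> K * (\<epsilon> / 2 + (x - y)\<^sup>2 / (2 * \<epsilon>))"
        using K by (intro mult_left_mono) simp_all
      with abs_diff_le_supnorm_deriv[OF f(2) deriv, of x y]
      show "\<bar>f x - f y\<bar> \<le> K * \<epsilon> / 2 + K / (2 * \<epsilon>) * (x - y)\<^sup>2"
        by (simp add: K_def algebra_simps)
    qed (use K \<epsilon> in auto)
    also have "ennreal (K * \<epsilon> / 2) * Xnorm \<rho> (L (\<lambda>_. 1)) \<le> ennreal (K * \<epsilon> / 2) * ennreal (a\<^sup>2)"
      using ab(3) by (intro mult_left_mono order.trans[OF c(2)] ennreal_leI) auto
    also have "ennreal (K / (2 * \<epsilon>)) * ennreal (\<mu>\<^sup>2) \<le> ennreal (K / (2 * \<epsilon>)) * ennreal (b\<^sup>2)"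
      using ab(4) by (intro mult_left_mono ennreal_leI) auto
    also have "ennreal (K * \<epsilon> / 2) * ennreal (a\<^sup>2) + ennreal (K / (2 * \<epsilon>)) * ennreal (b\<^sup>2)
        = ennreal (K * \<epsilon> / 2 * a\<^sup>2 + K / (2 * \<epsilon>) * b\<^sup>2)"
    proof -
      have "0 \<le> K * \<epsilon> / 2" "0 \<le> K / (2 * \<epsilon>)"
        using K \<epsilon> by simp_all
      then show ?thesis
        by (simp only: ennreal_plus ennreal_mult mult_nonneg_nonneg zero_le_power2)
    qed
    also have "K * \<epsilon> / 2 * a\<^sup>2 + K / (2 * \<epsilon>) * b\<^sup>2 = K * (a * b)"
    proof -
      have "K * \<epsilon> / 2 * a\<^sup>2 = K * (a * b) / 2" "K / (2 * \<epsilon>) * b\<^sup>2 = K * (a * b) / 2"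
        using ab(1,2) by (simp_all add: \<epsilon>_def power2_eq_square)
      then show ?thesis
        by linarith
    qed
    finally show ?thesis
      by (simp add: a_def b_def add_left_mono)
  qed
  have "((\<lambda>\<eta>. ?S + ennreal (K * ((sqrt c + \<eta>) * (\<mu> + \<eta>))))
      \<longlongrightarrow> ?S + ennreal (K * ((sqrt c + 0) * (\<mu> + 0)))) (at_right 0)"
    by (intro tendsto_intros)
  moreover have "\<forall>\<^sub>F \<eta> in at_right 0. ?N \<le> ?S + ennreal (K * ((sqrt c + \<eta>) * (\<mu> + \<eta>)))"
    using eventually_at_right_less[of "0 :: real"] by eventually_elim (rule bound)
  ultimately have "?N \<le> ?S + ennreal (K * ((sqrt c + 0) * (\<mu> + 0)))"
    by (rule tendsto_lowerbound) simp
  then show ?thesis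
    by (simp add: K_def mult_ac)
qed

section \<open>Combining the estimates, with and without \<open>L n\<close> fixing 1\<close>

theorem theorem15:
  fixes \<rho> :: "(real \<Rightarrow> real) \<Rightarrow> ennreal"
    and L :: "nat \<Rightarrow> (real \<Rightarrow> real) \<Rightarrow> real \<Rightarrow> real"
    and c :: real and \<mu> :: "nat \<Rightarrow> real"
  assumes "function_norm \<rho>"
    and "(\<lambda>_. 1) \<in> Xa \<rho>"
    and "\<And>n. n \<ge> 1 \<Longrightarrow> linear_operator \<rho> (L n)"
    and "\<And>n. n \<ge> 1 \<Longrightarrow> positive_operator \<rho> (L n)"
    and "0 \<le> c" and "(SUP n\<in>{1..}. Xnorm \<rho> (L n (\<lambda>_. 1))) = ennreal c"
    and "\<And>n. n \<ge> 1 \<Longrightarrow> 0 \<le> \<mu> n"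
    and "\<And>n. n \<ge> 1 \<Longrightarrow> ennreal ((\<mu> n)\<^sup>2) = ennreal (pi\<^sup>2) * Xnorm \<rho> (sin2_moment (L n))"
  shows "\<forall>f\<in>C2pi. \<forall>n\<ge>1.
      Xnorm \<rho> (\<lambda>x. L n f x - f x)
        \<le> ennreal (supnorm f) * Xnorm \<rho> (\<lambda>x. L n (\<lambda>_. 1) x - 1)
           + (Xnorm \<rho> (L n (\<lambda>_. 1)) + 1) * ennreal (modulus f (\<mu> n))
    \<and> ((AE x in lborel. L n (\<lambda>_. 1) x = 1) \<longrightarrow>
        Xnorm \<rho> (\<lambda>x. L n f x - f x) \<le> ennreal ((c + 1) * modulus f (\<mu> n)))
    \<and> (\<forall>f'\<in>C2pi. (\<forall>x. (f has_real_derivative f' x) (at x)) \<longrightarrow>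
        Xnorm \<rho> (\<lambda>x. L n f x - f x)
          \<le> ennreal (supnorm f) * Xnorm \<rho> (\<lambda>x. L n (\<lambda>_. 1) x - 1)
             + ennreal (sqrt c * \<mu> n * supnorm f')
             + ennreal ((sqrt c + 1) * \<mu> n * modulus f' (\<mu> n))
      \<and> ((AE x in lborel. L n (\<lambda>_. 1) x = 1) \<longrightarrow>
          Xnorm \<rho> (\<lambda>x. L n f x - f x)
            \<le> ennreal (sqrt c * \<mu> n * supnorm f' + (sqrt c + 1) * \<mu> n * modulus f' (\<mu> n))))"
proof (intro ballI allI impI)
  fix f and n :: nat
  assume f: "f \<in> C2pi" and n: "1 \<le> n"
  note \<rho> = assms(1,2) and L = assms(3)[OF n] assms(4)[OF n] and c = assms(5) and \<mu> = assms(7,8)[OF n]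
  let ?N = "Xnorm \<rho> (\<lambda>x. L n f x - f x)" and ?N1 = "Xnorm \<rho> (L n (\<lambda>_. 1))"
  let ?D = "Xnorm \<rho> (\<lambda>x. L n (\<lambda>_. 1) x - 1)"
  have N1: "?N1 \<le> ennreal c"
    unfolding assms(6)[symmetric] using n by (intro SUP_upper) simp
  then have fin: "?N1 < \<infinity>"
    by (rule le_less_trans) simp
  have \<omega>: "0 \<le> modulus f (\<mu> n)"
    by (rule modulus_nonneg[OF f \<mu>(1)])
  have D: "?D = 0" if "AE x in lborel. L n (\<lambda>_. 1) x = 1"
    using that linear_operator_measurable[OF \<rho> L(1) C2pi_const]
    by (intro Xnorm_eq_0[OF \<rho>(1)]) (auto simp: AE_leb_pi_iff intro!: measurable_leb_pi)
  have main: "?N \<le> ennreal (supnorm f) * ?D + (?N1 + 1) * ennreal (modulus f (\<mu> n))"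
    by (rule modulus_error_bound[OF \<rho> L f fin \<mu>])
  have unital: "?N \<le> ennreal ((c + 1) * modulus f (\<mu> n))" if "AE x in lborel. L n (\<lambda>_. 1) x = 1"
  proof -
    have "?N \<le> (?N1 + 1) * ennreal (modulus f (\<mu> n))"
      using main by (simp add: D[OF that])
    \<comment> \<open>The individual norm is replaced by the supremum \<open>c\<close>.\<close>
    also have "\<dots> \<le> (ennreal c + 1) * ennreal (modulus f (\<mu> n))"
      using N1 by (intro mult_right_mono add_right_mono) auto
    also have "\<dots> = ennreal ((c + 1) * modulus f (\<mu> n))"
      using c \<omega> by (simp add: ennreal_mult ennreal_plus)
    finally show ?thesis .
  qed
  have smooth: "?N \<le> ennreal (supnorm f) * ?D + ennreal (sqrt c * \<mu> n * supnorm f')"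
    "0 \<le> sqrt c * \<mu> n * supnorm f'" "0 \<le> (sqrt c + 1) * \<mu> n * modulus f' (\<mu> n)"
    if "f' \<in> C2pi" "\<forall>x. (f has_real_derivative f' x) (at x)" for f'
    using derivative_error_bound[OF \<rho> L f that(1) that(2)[rule_format] c N1 \<mu>]
      supnorm_nonneg[OF that(1)] modulus_nonneg[OF that(1) \<mu>(1)] c \<mu>(1)
    by simp_all
  show "?N \<le> ennreal (supnorm f) * ?D + (?N1 + 1) * ennreal (modulus f (\<mu> n))
    \<and> ((AE x in lborel. L n (\<lambda>_. 1) x = 1) \<longrightarrow> ?N \<le> ennreal ((c + 1) * modulus f (\<mu> n)))
    \<and> (\<forall>f'\<in>C2pi. (\<forall>x. (f has_real_derivative f' x) (at x)) \<longrightarrow>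
        ?N \<le> ennreal (supnorm f) * ?D + ennreal (sqrt c * \<mu> n * supnorm f')
             + ennreal ((sqrt c + 1) * \<mu> n * modulus f' (\<mu> n))
      \<and> ((AE x in lborel. L n (\<lambda>_. 1) x = 1) \<longrightarrow>
          ?N \<le> ennreal (sqrt c * \<mu> n * supnorm f' + (sqrt c + 1) * \<mu> n * modulus f' (\<mu> n))))"
  proof (intro conjI ballI impI main unital)
    fix f' assume f': "f' \<in> C2pi" "\<forall>x. (f has_real_derivative f' x) (at x)"
    note s = smooth[OF f']
    show "?N \<le> ennreal (supnorm f) * ?D + ennreal (sqrt c * \<mu> n * supnorm f')
        + ennreal ((sqrt c + 1) * \<mu> n * modulus f' (\<mu> n))"
      using s(1) by (rule add_increasing2[rotated]) simp
    assume one: "AE x in lborel. L n (\<lambda>_. 1) x = 1"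
    have "?N \<le> ennreal (sqrt c * \<mu> n * supnorm f')"
      using s(1) by (simp add: D[OF one])
    \<comment> \<open>The sum is formed inside \<open>ennreal\<close>, so the sign of the added real
      term, given by \<open>s(3)\<close>, matters.\<close>
    also have "\<dots> \<le> ennreal (sqrt c * \<mu> n * supnorm f' + (sqrt c + 1) * \<mu> n * modulus f' (\<mu> n))"
      using s(3) by (intro ennreal_leI) simp
    finally show "?N \<le> ennreal (sqrt c * \<mu> n * supnorm f' + (sqrt c + 1) * \<mu> n * modulus f' (\<mu> n))" .
  qed
qed

end
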